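(* Let $d>0$ be a real number. Let $G$ be any chordal graph and let $H$ be any subgraph of $G$ with $\mathrm{Mad}(H)\leq d$. Then $\mathrm{BBC}_2(G,H)\leq \omega(G)+2\sqrt{d\cdot\omega(G)}+3d$.
   Context: All graphs are finite and simple. A graph is chordal if it has no induced cycle of length at least $4$. For a positive integer $k$, $[k]=\{1,\dots,k\}$. Given a graph $G$, a subgraph $H$ of $G$, and positive integers $q,k$, a $q$-backbone $k$-colouring of $(G,H)$ is a map $c:V(G)\to[k]$ such that $c(u)\neq c(v)$ for every edge $uv\in E(G)$ and $|c(u)-c(v)|\geq q$ for every edge $uv\in E(H)$. $\mathrm{BBC}_q(G,H)$ is the minimum $k$ for which a $q$-backbone $k$-colouring of $(G,H)$ exists. $\omega(G)$ is the clique number of $G$. The maximum average degree of $H$ is $\mathrm{Mad}(H)=\max\{2|E(H')|/|V(H')| : H'\subseteq H,\ V(H')\neq\emptyset\}$. *)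

theory Defs
  imports Complex_Main "HOL-Library.Ramsey" "Graph_Theory.Graph_Theory"
begin

text \<open>
  Finite simple graphs are represented by the locale \<^locale>\<open>pair_graph\<close>: an undirected edge
  between \<open>u\<close> and \<open>v\<close> is the pair of opposite arcs \<open>(u, v)\<close>, \<open>(v, u)\<close>.  The edge set below
  contains each undirected edge once, so its cardinality is the usual number of edges.
\<close>

definition edges :: "'a pair_pre_digraph \<Rightarrow> 'a set set" where
  "edges G = {{u, v} | u v. (u, v) \<in> parcs G}"

definition clique_number :: "'a pair_pre_digraph \<Rightarrow> nat" where
  "clique_number G = Max {card K | K. K \<subseteq> pverts G \<and> clique K (edges G)}"

text \<open>
  A graph is a cycle of length \<open>n\<close> if it consists exactly of the vertices and edges of one of
  its cyclic walks.  The bound \<open>3 \<le> n\<close> is needed because \<^const>\<open>pre_digraph.cycle\<close> also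
  accepts the walk along a single edge and back.
\<close>

definition cycle_graph :: "nat \<Rightarrow> 'a pair_pre_digraph \<Rightarrow> bool" where
  "cycle_graph n C \<longleftrightarrow> pair_graph C \<and> 3 \<le> n \<and>
     (\<exists>p. pre_digraph.cycle (with_proj C) p \<and> length p = n \<and>
          pverts C = fst ` set p \<and> parcs C = set p \<union> (set p)\<inverse>)"

definition chordal :: "'a pair_pre_digraph \<Rightarrow> bool" where
  "chordal G \<longleftrightarrow>
     \<not> (\<exists>C n. induced_subgraph (with_proj C) (with_proj G) \<and> cycle_graph n C \<and> 4 \<le> n)"

text \<open>
  The graph without vertices has no subgraph to maximise over; its maximum average degree
  is set to 0.
\<close>

definition Mad :: "'a pair_pre_digraph \<Rightarrow> real" where
  "Mad H = (if pverts H = {} then 0 else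
     Max {2 * real (card (edges H')) / real (card (pverts H')) | H'.
            pair_graph H' \<and> subgraph (with_proj H') (with_proj H) \<and> pverts H' \<noteq> {}})"

definition backbone_colouring ::
    "nat \<Rightarrow> nat \<Rightarrow> 'a pair_pre_digraph \<Rightarrow> 'a pair_pre_digraph \<Rightarrow> ('a \<Rightarrow> nat) \<Rightarrow> bool" where
  "backbone_colouring q k G H c \<longleftrightarrow>
     c \<in> pverts G \<rightarrow> {1..k} \<and>
     (\<forall>(u, v) \<in> parcs G. c u \<noteq> c v) \<and>
     (\<forall>(u, v) \<in> parcs H. \<bar>int (c u) - int (c v)\<bar> \<ge> int q)"

text \<open>
  The value \<open>k = 0\<close> is possible only if \<open>G\<close> has no vertices; for every other graph the minimum
  is over positive \<open>k\<close>.
\<close>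

definition BBC :: "nat \<Rightarrow> 'a pair_pre_digraph \<Rightarrow> 'a pair_pre_digraph \<Rightarrow> nat" where
  "BBC q G H = (LEAST k. \<exists>c. backbone_colouring q k G H c)"

end

theory Submission
  imports Defs
begin

text \<open>
  Vertices are added to a set \<open>A\<close> one at a time so that every component \<open>X\<close> of \<open>G - A\<close> attaches
  to \<open>A\<close> in a clique \<open>K\<close>; chordality supplies a vertex \<open>v \<in> X\<close> complete to \<open>K\<close>, and adding it keeps
  this property.  Vertices are coloured ahead of this order: the coloured set \<open>S\<close> is the closure of
  \<open>A\<close> under adding any vertex that has at least \<open>t\<close> neighbours in \<open>H\<close> already present.  When \<open>v\<close> is
  added, the new vertices \<open>D\<close> of the closure all lie in \<open>X\<close> and their coloured \<open>G\<close>-neighbours lie in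
  \<open>(K \<union> {v}) \<union> W\<close>, where \<open>W\<close> is the set of other closure vertices in \<open>X\<close>.  Each vertex of
  \<open>W\<close> contributes \<open>t\<close> edges of \<open>H\<close> inside this set, so \<open>2 t |W| \<le> d (\<omega> + |W|)\<close> and \<open>W\<close> is small.
  A vertex of \<open>D\<close> has fewer than \<open>t\<close> neighbours in \<open>H\<close> among the vertices coloured before \<open>D\<close>, and
  \<open>D\<close> is coloured along a \<open>d\<close>-degenerate order of \<open>H\<close>, so greedy colouring
  succeeds with \<open>\<omega> + d \<omega> / (2 t - d) + 2 (t - 1) + 2 d\<close> colours.  Take \<open>2 t\<close> close to \<open>sqrt (d \<omega>) + d\<close>.
\<close>

subsection \<open>Components and cliques in graphs without holes\<close>

locale symmetric_rel =
  fixes V :: "'a set" and E :: "'a rel"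
  assumes finite_V: "finite V" and E_subset: "E \<subseteq> V \<times> V"
    and sym_E: "sym E" and irrefl_E: "irrefl E"
begin

text \<open>Vertices reachable from \<open>x\<close> without entering \<open>A\<close>. For
  \<open>x\<close> in \<open>A\<close> this is only \<open>{x}\<close>, hence the recurring premise
  \<open>x \<in> V - A\<close>.\<close>

definition component :: "'a set \<Rightarrow> 'a \<Rightarrow> 'a set" where
  "component A x = {y. (x, y) \<in> (E \<inter> (V - A) \<times> (V - A))\<^sup>*}"

lemma component_refl: "x \<in> component A x"
  by (simp add: component_def)

lemma component_subset: "x \<in> V - A \<Longrightarrow> component A x \<subseteq> V - A"
  unfolding component_def by (auto elim: rtranclE)

lemma component_eq:
  assumes "y \<in> component A x"
  shows "component A y = component A x"
proof -
  let ?R = "E \<inter> (V - A) \<times> (V - A)"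
  have "sym ?R" using sym_E by (auto simp: sym_def)
  then have "sym (?R\<^sup>*)" by (rule sym_rtrancl)
  then have "(y, x) \<in> ?R\<^sup>*" using assms by (auto simp: component_def sym_def)
  with assms show ?thesis by (auto simp: component_def)
qed

lemma component_step:
  assumes "y \<in> component A x" "x \<in> V - A" "(y, z) \<in> E" "z \<notin> A"
  shows "z \<in> component A x"
proof -
  have "(y, z) \<in> E \<inter> (V - A) \<times> (V - A)"
    using assms component_subset[of x A] E_subset by auto
  then show ?thesis using assms(1) by (auto simp: component_def intro: rtrancl_into_rtrancl)
qed

lemma component_mono: "A \<subseteq> B \<Longrightarrow> component B x \<subseteq> component A x"
proof -
  assume "A \<subseteq> B"
  then have "(E \<inter> (V - B) \<times> (V - B))\<^sup>* \<subseteq> (E \<inter> (V - A) \<times> (V - A))\<^sup>*"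
    by (intro rtrancl_mono) auto
  then show ?thesis by (auto simp: component_def)
qed

definition complete_on :: "'a set \<Rightarrow> bool" where
  "complete_on K \<longleftrightarrow> (\<forall>x\<in>K. \<forall>y\<in>K. x \<noteq> y \<longrightarrow> (x, y) \<in> E)"

definition clique_separated :: "'a set \<Rightarrow> bool" where
  "clique_separated A \<longleftrightarrow> (\<forall>x\<in>V - A. complete_on (E `` component A x \<inter> A))"

text \<open>Every component left after deleting \<open>v\<close> as well lies in an old one. If
  \<open>v\<close> is adjacent to it, that old one is the component of \<open>x\<close>, and its
  attachments are at most the old clique and \<open>v\<close>, which is complete to that clique.
  Otherwise its attachments in \<open>A\<close> are among those of the old component.\<close>

lemma clique_separated_insert:
  assumes A: "clique_separated A" and x: "x \<in> V - A" and v: "v \<in> component A x"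
    and full: "\<And>k. k \<in> E `` component A x \<inter> A \<Longrightarrow> (v, k) \<in> E"
  shows "clique_separated (insert v A)"
  unfolding clique_separated_def
proof
  fix y assume y: "y \<in> V - insert v A"
  have sub: "component (insert v A) y \<subseteq> component A y" by (rule component_mono) auto
  show "complete_on (E `` component (insert v A) y \<inter> insert v A)"
  proof (cases "v \<in> E `` component (insert v A) y")
    case True
    have "v \<notin> A" using component_subset[OF x] v by auto
    then have "v \<in> component A y" using True sub y component_step[of _ A y v] by auto
    then have eq: "component A y = component A x" using component_eq v by metis
    have "complete_on (E `` component A x \<inter> A)"
      using A x by (auto simp: clique_separated_def)
    then have "complete_on (insert v (E `` component A x \<inter> A))"
      using full sym_E unfolding complete_on_def sym_def by blast
    then show ?thesis using sub unfolding eq complete_on_def by blast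
  next
    case False
    have "complete_on (E `` component A y \<inter> A)"
      using A y by (auto simp: clique_separated_def)
    then show ?thesis using sub False unfolding complete_on_def by blast
  qed
qed

end

section \<open>Holes, shortest paths and common neighbours of a clique\<close>

locale hole_free = symmetric_rel +
  assumes no_hole: "\<And>n g. 4 \<le> n \<Longrightarrow> inj_on g {..<n} \<Longrightarrow> g ` {..<n} \<subseteq> V \<Longrightarrow>
     \<not> (\<forall>i<n. \<forall>j<n. (g i, g j) \<in> E \<longleftrightarrow> j = Suc i mod n \<or> i = Suc j mod n)"
begin

text \<open>An induced path whose two ends are joined through the edge \<open>ab\<close> closes up
  to an induced cycle on \<open>l + 3\<close> vertices; \<open>1 \<le> l\<close> makes this at least
  4.\<close>

lemma no_hole_through_path:
  assumes l: "1 \<le> l" and f: "inj_on f {..l}" "f ` {..l} \<subseteq> V"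
    and fE: "\<And>i j. i \<le> l \<Longrightarrow> j \<le> l \<Longrightarrow> (f i, f j) \<in> E \<longleftrightarrow> j = Suc i \<or> i = Suc j"
    and a: "\<And>i. i \<le> l \<Longrightarrow> (f i, a) \<in> E \<longleftrightarrow> i = l"
    and b: "\<And>i. i \<le> l \<Longrightarrow> (f i, b) \<in> E \<longleftrightarrow> i = 0"
    and ab: "(a, b) \<in> E" "a \<notin> f ` {..l}" "b \<notin> f ` {..l}"
  shows False
proof -
  \<comment> \<open>The cyclic order is \<open>f 0\<close>, ..., \<open>f l\<close>,
    \<open>a\<close>, \<open>b\<close>, so only the index \<open>l + 2\<close> wraps around.\<close>
  define g where "g i = (if i \<le> l then f i else if i = l + 1 then a else b)" for i
  define n where "n = l + 3"
  have "a \<noteq> b" "a \<in> V" "b \<in> V" using ab irrefl_E E_subset by (auto simp: irrefl_def)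
  have cs: "i \<le> l \<or> i = l + 1 \<or> i = l + 2" if "i < n" for i using that n_def by linarith
  have sE: "(x, y) \<in> E \<longleftrightarrow> (y, x) \<in> E" for x y using sym_E by (auto simp: sym_def)
  have rE: "(x, x) \<notin> E" for x using irrefl_E by (auto simp: irrefl_def)
  have a': "(a, f i) \<in> E \<longleftrightarrow> i = l" if "i \<le> l" for i using a[OF that] sE by blast
  have b': "(b, f i) \<in> E \<longleftrightarrow> i = 0" if "i \<le> l" for i using b[OF that] sE by blast
  have ba: "(b, a) \<in> E" using ab sE by blast
  have "inj_on g {..<n}"
  proof (rule inj_onI)
    fix i j assume "i \<in> {..<n}" "j \<in> {..<n}" and eq: "g i = g j"
    then have "i \<le> l \<or> i = l + 1 \<or> i = l + 2" "j \<le> l \<or> j = l + 1 \<or> j = l + 2"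
      using cs by auto
    then show "i = j"
      using eq f(1) ab(2,3) \<open>a \<noteq> b\<close> by (elim disjE) (auto simp: g_def inj_on_def image_iff)
  qed
  moreover have "g ` {..<n} \<subseteq> V"
    using f(2) \<open>a \<in> V\<close> \<open>b \<in> V\<close> by (auto simp: g_def image_subset_iff)
  moreover have "(g i, g j) \<in> E \<longleftrightarrow> j = Suc i mod n \<or> i = Suc j mod n" if "i < n" "j < n" for i j
  proof -
    have m: "Suc i mod n = (if i = l + 2 then 0 else Suc i)" if "i < n" for i
    proof (cases "i = l + 2")
      case True
      then have "Suc i = n" using n_def by simp
      then show ?thesis using True by simp
    next
      case False
      then show ?thesis using that n_def by simp
    qed
    show ?thesis
      using cs[OF that(1)] cs[OF that(2)] l
      unfolding m[OF that(1)] m[OF that(2)]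
      by (elim disjE) (auto simp: g_def fE a b a' b' ab ba rE)
  qed
  ultimately show False using no_hole[of n g] l n_def by auto
qed

lemma common_neighbour_of_clique:
  assumes x: "x \<in> V - A" and K: "complete_on K" "K \<subseteq> E `` component A x \<inter> A"
  obtains v where "v \<in> component A x" "\<And>k. k \<in> K \<Longrightarrow> (v, k) \<in> E"
proof -
  let ?X = "component A x" and ?R = "E \<inter> (V - A) \<times> (V - A)"
  have sE: "(x, y) \<in> E \<longleftrightarrow> (y, x) \<in> E" for x y using sym_E by (auto simp: sym_def)
  have rE: "(x, x) \<notin> E" for x using irrefl_E by (auto simp: irrefl_def)
  have XV: "?X \<subseteq> V - A" using component_subset x by blast
  have "K \<subseteq> V" using K(2) E_subset by auto
  then have finK: "finite K" using finite_V by (rule finite_subset)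
  have finX: "finite ?X" using XV finite_V by (meson finite_Diff finite_subset)
  txt \<open>
    A vertex \<open>v\<close> with the most neighbours in \<open>K\<close> is complete to \<open>K\<close>: otherwise let \<open>z\<close> be the end of a
    shortest path from \<open>v\<close> to a neighbour of some missed \<open>k\<close>.  If \<open>z\<close> missed a neighbour \<open>k'\<close> of \<open>v\<close>
    in \<open>K\<close>, the path from the last neighbour of \<open>k'\<close> on it would close up through \<open>k\<close> and \<open>k'\<close> to a
    hole, so \<open>z\<close> has more neighbours in \<open>K\<close> than \<open>v\<close>.
  \<close>
  let ?deg = "\<lambda>v. card (E `` {v} \<inter> K)"
  have "Max (?deg ` ?X) \<in> ?deg ` ?X"
    using finX component_refl[of x A] by (intro Max_in) auto
  then obtain v where v: "v \<in> ?X" "?deg v = Max (?deg ` ?X)" by fastforce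
  have vX: "v \<in> ?X" by fact
  have vmax: "?deg y \<le> ?deg v" if "y \<in> ?X" for y
    unfolding v(2) using finX that by (intro Max_ge) auto
  have "(v, k) \<in> E" if k: "k \<in> K" for k
  proof (rule ccontr)
    assume nk: "(v, k) \<notin> E"
    obtain z where z: "z \<in> ?X" "(z, k) \<in> E" using K k by auto
    have "z \<in> component A v" using component_eq[OF vX] z by simp
    then have "(v, z) \<in> ?R\<^sup>*" by (simp add: component_def)
    then have ex: "\<exists>m z. (v, z) \<in> ?R ^^ m \<and> (z, k) \<in> E" using z by (meson rtrancl_imp_relpow)
    define m where "m = (LEAST m. \<exists>z. (v, z) \<in> ?R ^^ m \<and> (z, k) \<in> E)"
    obtain z where z: "(v, z) \<in> ?R ^^ m" "(z, k) \<in> E"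
      using LeastI_ex[OF ex] unfolding m_def by blast
    have least: "m \<le> m'" if "(v, y) \<in> ?R ^^ m'" "(y, k) \<in> E" for m' y
      unfolding m_def by (rule Least_le) (use that in blast)
    obtain f where f: "f 0 = v" "f m = z" "\<And>i. i < m \<Longrightarrow> (f i, f (Suc i)) \<in> ?R"
      using z(1) unfolding relpow_fun_conv by blast
    have seg: "(f i, f (i + n)) \<in> ?R ^^ n" if "i + n \<le> m" for i n
      using that
    proof (induction n)
      case (Suc n)
      then show ?case using f(3)[of "i + n"] by auto
    qed simp
    have fX: "f i \<in> ?X" if "i \<le> m" for i
    proof -
      have "(v, f i) \<in> ?R ^^ i" using seg[of 0 i] that f by simp
      then have "f i \<in> component A v" unfolding component_def by (simp add: relpow_imp_rtrancl)
      then show ?thesis using component_eq[OF vX] by simp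
    qed
    then have fV: "f i \<in> V" "f i \<notin> A" if "i \<le> m" for i using XV that by auto
    have only_last: "i = m" if "i \<le> m" "(f i, k) \<in> E" for i
      using least[of "f i" i] seg[of 0 i] that f by auto
    \<comment> \<open>Replacing the stretch from \<open>f i\<close> to \<open>f j\<close> by a walk
      of length \<open>r\<close> cannot beat the minimal \<open>m\<close>. The case
      \<open>r = 1\<close> shows that the path has no chords, the case \<open>r = 0\<close> that it
      repeats no vertex.\<close>
    have shortcut: "j \<le> i + r" if "i \<le> m" "j \<le> m" "(f i, f j) \<in> ?R ^^ r" for i j r
    proof -
      have "(v, f i) \<in> ?R ^^ i" using seg[of 0 i] that f by simp
      moreover have "(f j, z) \<in> ?R ^^ (m - j)" using seg[of j "m - j"] that f by simp
      ultimately have "(v, z) \<in> ?R ^^ (i + r + (m - j))"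
        using that(3) by (auto simp: relpow_add)
      then show ?thesis using least z(2) that by fastforce
    qed
    have R1: "(f i, f j) \<in> ?R ^^ 1 \<longleftrightarrow> (f i, f j) \<in> E" if "i \<le> m" "j \<le> m" for i j
      using fX[OF that(1)] fX[OF that(2)] XV by auto
    have fE: "(f i, f j) \<in> E \<longleftrightarrow> j = Suc i \<or> i = Suc j" if "i \<le> m" "j \<le> m" for i j
    proof
      assume e: "(f i, f j) \<in> E"
      then have "(f j, f i) \<in> E" using sE by blast
      then have "j \<le> i + 1" "i \<le> j + 1" "i \<noteq> j"
        using e shortcut R1 that rE by blast+
      then show "j = Suc i \<or> i = Suc j" by linarith
    next
      assume "j = Suc i \<or> i = Suc j"
      then show "(f i, f j) \<in> E" using f(3)[of i] f(3)[of j] sE that by auto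
    qed
    have finj: "inj_on f {..m}"
    proof (rule inj_onI)
      fix i j assume "i \<in> {..m}" "j \<in> {..m}" "f i = f j"
      then have "j \<le> i + 0" "i \<le> j + 0" by (intro shortcut; simp)+
      then show "i = j" by simp
    qed
    have zk: "z \<in> ?X" using fX[of m] f by simp
    have "(z, k') \<in> E" if k': "k' \<in> K" "(v, k') \<in> E" for k'
    proof (rule ccontr)
      assume nz: "(z, k') \<notin> E"
      define j where "j = Max {i. i \<le> m \<and> (f i, k') \<in> E}"
      have "j \<in> {i. i \<le> m \<and> (f i, k') \<in> E}"
        unfolding j_def using k' f by (intro Max_in) auto
      then have j: "j \<le> m" "(f j, k') \<in> E" by auto
      then have "j \<noteq> m" using nz f by auto
      with j have jm: "j < m" by simp
      have jmax: "i \<le> j" if "i \<le> m" "(f i, k') \<in> E" for i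
        unfolding j_def using that by (intro Max_ge) auto
      \<comment> \<open>\<open>k\<close> and \<open>k'\<close> differ because \<open>v\<close> is
        adjacent to \<open>k'\<close> but not to \<open>k\<close>.\<close>
      have kk: "(k, k') \<in> E" using K(1) k k' nk unfolding complete_on_def by metis
      have "k \<in> A" "k' \<in> A" using K(2) k k' by auto
      have notA: "f (j + i) \<notin> A" if "i \<le> m - j" for i
        using fV(2)[of "j + i"] that jm by simp
      show False
      proof (rule no_hole_through_path[of "m - j" "\<lambda>i. f (j + i)" k k'])
        show "1 \<le> m - j" using jm by simp
        show "inj_on (\<lambda>i. f (j + i)) {..m - j}"
          using jm by (intro inj_onI) (auto dest!: inj_onD[OF finj])
        show "(\<lambda>i. f (j + i)) ` {..m - j} \<subseteq> V" using fV jm by auto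
        show "(f (j + i), f (j + i')) \<in> E \<longleftrightarrow> i' = Suc i \<or> i = Suc i'"
          if "i \<le> m - j" "i' \<le> m - j" for i i' using fE[of "j + i" "j + i'"] that jm by auto
        show "(f (j + i), k) \<in> E \<longleftrightarrow> i = m - j" if "i \<le> m - j" for i
        proof -
          have "j + i \<le> m" "i = m - j \<longleftrightarrow> j + i = m" using that jm by linarith+
          then show ?thesis using only_last[of "j + i"] z(2) f(2) by metis
        qed
        show "(f (j + i), k') \<in> E \<longleftrightarrow> i = 0" if "i \<le> m - j" for i
          using jmax[of "j + i"] that jm j by auto
        show "(k, k') \<in> E" by fact
        show "k \<notin> (\<lambda>i. f (j + i)) ` {..m - j}" "k' \<notin> (\<lambda>i. f (j + i)) ` {..m - j}"
          using notA \<open>k \<in> A\<close> \<open>k' \<in> A\<close> by auto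
      qed
    qed
    then have "E `` {v} \<inter> K \<subset> E `` {z} \<inter> K" using nk z(2) k by auto
    then have "card (E `` {v} \<inter> K) < card (E `` {z} \<inter> K)"
      using finK by (intro psubset_card_mono) auto
    then show False using vmax[OF zk] by simp
  qed
  then show thesis using that vX by blast
qed

end

subsection \<open>Greedy colouring with promoted vertices\<close>

text \<open>\<open>F\<close> holds the arcs of the backbone. Both orientations of an edge are
  counted, so \<open>sparse\<close> says that the average degree of \<open>F\<close> within
  \<open>S\<close> is at most \<open>d\<close>.\<close>

locale sparse_backbone = hole_free +
  fixes F :: "'a rel" and d :: real and \<omega> t :: nat
  assumes F_subset: "F \<subseteq> E" and sym_F: "sym F"
    and d_pos: "0 < d" and t_large: "d < 2 * real t"
    and clique_le: "\<And>K. K \<subseteq> V \<Longrightarrow> complete_on K \<Longrightarrow> card K \<le> \<omega>"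
    and sparse: "\<And>S. S \<subseteq> V \<Longrightarrow> real (card (F \<inter> S \<times> S)) \<le> d * real (card S)"
begin

lemma finite_F: "finite F"
  using F_subset E_subset finite_V by (meson finite_SigmaI finite_subset)

lemma finite_neighbours: "finite (F `` X)" "finite (E `` X)"
proof -
  have "F `` X \<subseteq> V" "E `` X \<subseteq> V" using F_subset E_subset by auto
  then show "finite (F `` X)" "finite (E `` X)" using finite_V finite_subset by blast+
qed

text \<open>All stages on the way to the closure of \<open>A\<close> are members, not only the
  closure itself; the order of insertion is what \<open>grow_arcs\<close> counts along.\<close>

inductive_set grow :: "'a set \<Rightarrow> 'a set set" for A where
  empty: "{} \<in> grow A"
| insert: "S \<in> grow A \<Longrightarrow> w \<in> V \<Longrightarrow> w \<notin> S \<Longrightarrow> w \<in> A \<or> t \<le> card (F `` {w} \<inter> S)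
     \<Longrightarrow> insert w S \<in> grow A"

lemma grow_mono: "S \<in> grow A \<Longrightarrow> A \<subseteq> B \<Longrightarrow> S \<in> grow B"
  by (induction rule: grow.induct) (auto intro: grow.intros)

lemma grow_subset: "S \<in> grow A \<Longrightarrow> S \<subseteq> V"
  by (induction rule: grow.induct) auto

text \<open>A vertex of \<open>W\<close> is outside \<open>A\<close>, so it can enter only with
  \<open>t\<close> neighbours in \<open>F\<close> already present. These give \<open>2 * t\<close>
  arcs, counted in both directions, and all are new since the vertex was absent before.\<close>

lemma grow_arcs:
  assumes "S \<in> grow A" "W \<inter> A = {}"
  shows "2 * t * card (W \<inter> S) \<le> card {(x, y) \<in> F. x \<in> S \<and> y \<in> S \<and> (x \<in> W \<or> y \<in> W)}"
  using assms(1)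
proof (induction rule: grow.induct)
  case empty
  then show ?case by simp
next
  case (insert S w)
  define arcs where "arcs S = {(x, y) \<in> F. x \<in> S \<and> y \<in> S \<and> (x \<in> W \<or> y \<in> W)}" for S
  have fin: "finite (arcs S)" for S using finite_F by (rule rev_finite_subset) (auto simp: arcs_def)
  have finS: "finite S" using grow_subset[OF insert(1)] finite_V by (rule finite_subset)
  show ?case
  proof (cases "w \<in> W")
    case False
    then have "W \<inter> insert w S = W \<inter> S" by auto
    moreover have "card (arcs S) \<le> card (arcs (insert w S))"
      by (intro card_mono fin) (auto simp: arcs_def)
    ultimately show ?thesis using insert.IH unfolding arcs_def by simp
  next
    case True
    let ?T = "F `` {w} \<inter> S"
    have T: "t \<le> card ?T" using True insert.hyps assms(2) by auto
    have finT: "finite ?T" using finS by simp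
    have "arcs S \<union> ({w} \<times> ?T \<union> ?T \<times> {w}) \<subseteq> arcs (insert w S)"
      using True sym_F by (auto simp: arcs_def sym_def)
    then have "card (arcs S \<union> ({w} \<times> ?T \<union> ?T \<times> {w})) \<le> card (arcs (insert w S))"
      by (intro card_mono fin)
    moreover have "card (arcs S \<union> ({w} \<times> ?T \<union> ?T \<times> {w})) = card (arcs S) + card ({w} \<times> ?T \<union> ?T \<times> {w})"
      using fin finT insert.hyps by (intro card_Un_disjoint) (auto simp: arcs_def)
    moreover have "card ({w} \<times> ?T \<union> ?T \<times> {w}) = card ({w} \<times> ?T) + card (?T \<times> {w})"
      using finT insert.hyps by (intro card_Un_disjoint) auto
    ultimately have "card (arcs S) + 2 * card ?T \<le> card (arcs (insert w S))"
      by (simp add: card_cartesian_product)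
    moreover have "card (W \<inter> insert w S) = card (W \<inter> S) + 1"
      using True insert.hyps finS by simp
    moreover have "2 * t * card (W \<inter> S) \<le> card (arcs S)" using insert.IH by (simp add: arcs_def)
    ultimately show ?thesis using T by (simp add: arcs_def algebra_simps)
  qed
qed

text \<open>\<open>promoted_bound\<close> bounds the size of \<open>W\<close> in \<open>colour_step\<close>.\<close>

definition promoted_bound :: nat where
  "promoted_bound = nat \<lfloor>d * real \<omega> / (2 * real t - d)\<rfloor>"

text \<open>Fewer than \<open>\<omega> + promoted_bound\<close> colours are excluded by neighbours
  in \<open>E\<close>. Each of the at most \<open>t - 1 + nat \<lfloor>d\<rfloor>\<close> neighbours
  in \<open>F\<close> excludes two more, the colours next to its own.\<close>

definition colours :: nat where
  "colours = \<omega> + promoted_bound + 2 * (t - 1) + 2 * nat \<lfloor>d\<rfloor>"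

section \<open>Greedy extension of partial colourings\<close>

definition proper_on :: "'a set \<Rightarrow> ('a \<Rightarrow> nat) \<Rightarrow> bool" where
  "proper_on S c \<longleftrightarrow> c \<in> S \<rightarrow> {1..colours} \<and>
     (\<forall>x\<in>S. \<forall>y\<in>S. ((x, y) \<in> E \<longrightarrow> c x \<noteq> c y) \<and>
        ((x, y) \<in> F \<longrightarrow> \<bar>int (c x) - int (c y)\<bar> \<ge> 2))"

text \<open>Averaging: if all degrees within \<open>D\<close> exceeded \<open>d\<close>, their sum,
  which is the number of arcs of \<open>F\<close> inside \<open>D\<close>, would contradict
  \<open>sparse\<close>.\<close>

lemma exists_low_degree:
  assumes D: "D \<subseteq> V" "D \<noteq> {}"
  obtains v where "v \<in> D" "card (F `` {v} \<inter> D) \<le> nat \<lfloor>d\<rfloor>"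
proof (rule ccontr)
  assume "\<not> thesis"
  then have less: "nat \<lfloor>d\<rfloor> < card (F `` {v} \<inter> D)" if "v \<in> D" for v
    using that \<open>\<And>v. v \<in> D \<Longrightarrow> card (F `` {v} \<inter> D) \<le> nat \<lfloor>d\<rfloor> \<Longrightarrow> thesis\<close> not_le by blast
  have finD: "finite D" using D(1) finite_V by (rule finite_subset)
  have "d < real (card (F `` {v} \<inter> D))" if "v \<in> D" for v
    using less[OF that] d_pos by linarith
  then have "(\<Sum>v\<in>D. d) < (\<Sum>v\<in>D. real (card (F `` {v} \<inter> D)))"
    using finD D(2) by (intro sum_strict_mono) auto
  also have "\<dots> = real (card (SIGMA v:D. F `` {v} \<inter> D))"
    using finD by (subst card_SigmaI) auto
  also have "(SIGMA v:D. F `` {v} \<inter> D) = F \<inter> D \<times> D" by auto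
  also have "real (card (F \<inter> D \<times> D)) \<le> d * real (card D)" by (rule sparse) (rule D)
  finally show False by (simp add: mult.commute)
qed

lemma extend_by_vertex:
  assumes c: "proper_on S c" and v: "v \<in> V - S"
    and E: "card (E `` {v} \<inter> S) < \<omega> + promoted_bound"
    and F: "card (F `` {v} \<inter> S) \<le> t - 1 + nat \<lfloor>d\<rfloor>"
  obtains c' where "proper_on (insert v S) c'"
proof -
  let ?P = "c ` (E `` {v} \<inter> S)" and ?N = "F `` {v} \<inter> S"
  \<comment> \<open>The forbidden colours: those of neighbours in \<open>E\<close>, and the
    successor and predecessor of the colour of each neighbour in \<open>F\<close>.\<close>
  let ?Q = "?P \<union> ((\<lambda>y. c y + 1) ` ?N \<union> (\<lambda>y. c y - 1) ` ?N)"
  have fin: "finite ?N" "finite (E `` {v} \<inter> S)" using finite_neighbours by auto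
  have "card ?Q \<le> card ?P + card ((\<lambda>y. c y + 1) ` ?N \<union> (\<lambda>y. c y - 1) ` ?N)" by (rule card_Un_le)
  also have "card ((\<lambda>y. c y + 1) ` ?N \<union> (\<lambda>y. c y - 1) ` ?N) \<le>
      card ((\<lambda>y. c y + 1) ` ?N) + card ((\<lambda>y. c y - 1) ` ?N)" by (rule card_Un_le)
  finally have "card ?Q \<le> card (E `` {v} \<inter> S) + card ?N + card ?N"
    using card_image_le[OF fin(1), of "\<lambda>y. c y + 1"] card_image_le[OF fin(1), of "\<lambda>y. c y - 1"]
      card_image_le[OF fin(2), of c] by linarith
  then have "card ?Q < card {1..colours}" using E F by (simp add: colours_def)
  moreover have "finite ?Q" using fin by auto
  ultimately have "\<not> {1..colours} \<subseteq> ?Q" using card_mono[of ?Q "{1..colours}"] by linarith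
  then obtain a where a: "a \<in> {1..colours}" "a \<notin> ?Q" by blast
  have ne: "a \<noteq> c y" if "y \<in> S" "(v, y) \<in> E" for y using a that by auto
  have far: "\<bar>int a - int (c y)\<bar> \<ge> 2" if "y \<in> S" "(v, y) \<in> F" for y
  proof -
    \<comment> \<open>Colours start at 1, so the truncated \<open>c y - 1\<close> is the true
      predecessor.\<close>
    have "c y \<ge> 1" using c that by (auto simp: proper_on_def)
    moreover have "a \<noteq> c y" using ne that F_subset by auto
    moreover have "a \<noteq> c y + 1" "a \<noteq> c y - 1" using a that by auto
    ultimately show ?thesis by linarith
  qed
  have sE: "(x, y) \<in> E \<longleftrightarrow> (y, x) \<in> E" for x y using sym_E by (auto simp: sym_def)
  have sF: "(x, y) \<in> F \<longleftrightarrow> (y, x) \<in> F" for x y using sym_F by (auto simp: sym_def)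
  have rE: "(x, x) \<notin> E" for x using irrefl_E by (auto simp: irrefl_def)
  have rF: "(x, x) \<notin> F" for x using rE F_subset by auto
  let ?c = "c(v := a)"
  have "?c x \<noteq> ?c y" if "x \<in> insert v S" "y \<in> insert v S" "(x, y) \<in> E" for x y
    using that ne[of x] ne[of y] c v rE sE[of x y] by (auto simp: proper_on_def)
  moreover have "\<bar>int (?c x) - int (?c y)\<bar> \<ge> 2"
    if "x \<in> insert v S" "y \<in> insert v S" "(x, y) \<in> F" for x y
    using that far[of x] far[of y] c v rF sF[of x y]
    by (auto simp: proper_on_def abs_minus_commute)
  moreover have "?c \<in> insert v S \<rightarrow> {1..colours}" using c a by (auto simp: proper_on_def)
  ultimately have "proper_on (insert v S) ?c" unfolding proper_on_def by blast
  then show thesis by (rule that)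
qed

text \<open>A vertex of low degree within \<open>D\<close> is coloured last. It then sees at most
  \<open>t - 1\<close> neighbours of \<open>F\<close> in \<open>S\<close> and at most
  \<open>nat \<lfloor>d\<rfloor>\<close> in \<open>D\<close>, as \<open>extend_by_vertex\<close>
  requires.\<close>

lemma extend_colouring:
  assumes "proper_on S c" "D \<subseteq> V" "D \<inter> S = {}"
    and "\<And>w. w \<in> D \<Longrightarrow> card (E `` {w} \<inter> (S \<union> D)) < \<omega> + promoted_bound"
    and "\<And>w. w \<in> D \<Longrightarrow> card (F `` {w} \<inter> S) < t"
  shows "\<exists>c'. proper_on (S \<union> D) c'"
  using assms(2-)
proof (induction "card D" arbitrary: D)
  case 0
  then have "D = {}" using finite_V finite_subset by fastforce
  then show ?case using assms(1) by auto
next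
  case (Suc n)
  have finD: "finite D" using Suc.prems finite_V finite_subset by blast
  obtain v where v: "v \<in> D" "card (F `` {v} \<inter> D) \<le> nat \<lfloor>d\<rfloor>"
    using exists_low_degree Suc.prems(1) Suc.hyps(2) by (metis card.empty nat.distinct(1))
  have "card (E `` {w} \<inter> (S \<union> (D - {v}))) < \<omega> + promoted_bound" if "w \<in> D - {v}" for w
  proof -
    have "card (E `` {w} \<inter> (S \<union> (D - {v}))) \<le> card (E `` {w} \<inter> (S \<union> D))"
      using finite_neighbours by (intro card_mono) auto
    then show ?thesis using Suc.prems(3)[of w] that by auto
  qed
  then obtain c' where c': "proper_on (S \<union> (D - {v})) c'"
    using Suc.hyps(1)[of "D - {v}"] Suc.hyps(2) Suc.prems v finD by force
  have "card (E `` {v} \<inter> (S \<union> (D - {v}))) \<le> card (E `` {v} \<inter> (S \<union> D))"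
    using finite_neighbours by (intro card_mono) auto
  then have "card (E `` {v} \<inter> (S \<union> (D - {v}))) < \<omega> + promoted_bound"
    using Suc.prems(3)[OF v(1)] by simp
  moreover have "card (F `` {v} \<inter> (S \<union> (D - {v}))) \<le> t - 1 + nat \<lfloor>d\<rfloor>"
  proof -
    have "card (F `` {v} \<inter> (S \<union> (D - {v}))) \<le> card ((F `` {v} \<inter> S) \<union> (F `` {v} \<inter> D))"
      using finite_neighbours by (intro card_mono) auto
    also have "\<dots> \<le> card (F `` {v} \<inter> S) + card (F `` {v} \<inter> D)" by (rule card_Un_le)
    finally show ?thesis using Suc.prems(4)[OF v(1)] v(2) by linarith
  qed
  moreover have "v \<in> V - (S \<union> (D - {v}))" using v Suc.prems by auto
  ultimately obtain c'' where "proper_on (insert v (S \<union> (D - {v}))) c''"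
    using extend_by_vertex[OF c'] by blast
  moreover have "insert v (S \<union> (D - {v})) = S \<union> D" using v by auto
  ultimately show ?case by auto
qed

section \<open>Saturated sets and the induction over the clique-separated sets\<close>

lemma saturate:
  assumes A: "A \<subseteq> S" and x: "x \<in> V - A" and v: "v \<in> component A x"
    and S: "S \<in> grow A" and sat: "\<And>w. w \<in> V - S \<Longrightarrow> card (F `` {w} \<inter> S) < t"
  obtains S' where "S \<subseteq> S'" "S' \<in> grow (insert v A)" "v \<in> S'" "S' - S \<subseteq> component A x"
    "\<And>w. w \<in> V - S' \<Longrightarrow> card (F `` {w} \<inter> S') < t"
proof -
  \<comment> \<open>A maximal member of this family is taken. Confinement to the component is part
    of the family, so it has to be checked for each further vertex that could be added.\<close>
  let ?Q = "{S'. S \<subseteq> S' \<and> S' \<in> grow (insert v A) \<and> S' - S \<subseteq> component A x}"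
  have vV: "v \<in> V" using component_subset x v by blast
  have "S \<in> ?Q" using grow_mono[OF S, of "insert v A"] by auto
  moreover have "finite ?Q"
    using finite_V by (intro finite_subset[of ?Q "Pow V"]) (auto dest: grow_subset)
  ultimately obtain S' where S': "S' \<in> ?Q" and max: "\<And>T. T \<in> ?Q \<Longrightarrow> S' \<subseteq> T \<Longrightarrow> S' = T"
    using finite_has_maximal[of ?Q] by (metis (no_types, lifting) empty_iff)
  have "v \<in> S'"
  proof (rule ccontr)
    assume nv: "v \<notin> S'"
    then have "insert v S' \<in> ?Q" using S' v vV by (auto intro: grow.insert)
    then show False using max nv by blast
  qed
  moreover have "card (F `` {w} \<inter> S') < t" if w: "w \<in> V - S'" for w
  proof (rule ccontr)
    assume ge: "\<not> card (F `` {w} \<inter> S') < t"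
    have "card (F `` {w} \<inter> S) < t" using sat w S' by auto
    \<comment> \<open>Since \<open>S\<close> was saturated, some neighbour of \<open>w\<close> is
      new and hence lies in the component of \<open>x\<close>. As \<open>w\<close> is outside
      \<open>A\<close>, it lies there too and could be added, against maximality.\<close>
    then have "\<not> F `` {w} \<inter> S' \<subseteq> F `` {w} \<inter> S"
      using ge card_mono[of "F `` {w} \<inter> S" "F `` {w} \<inter> S'"] finite_neighbours(1)[of "{w}"]
      by (meson finite_Int le_less_trans)
    then obtain y where y: "(w, y) \<in> F" "y \<in> S' - S" by auto
    then have "(y, w) \<in> E" using F_subset sym_E by (auto simp: sym_def)
    moreover have "w \<notin> A" using w A S' by auto
    ultimately have "w \<in> component A x" using component_step[of y A x w] y S' x by auto
    then have "insert w S' \<in> ?Q" using S' w ge by (auto intro: grow.insert)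
    then show False using max w by blast
  qed
  ultimately show thesis using that S' by blast
qed

text \<open>The neighbours of \<open>w\<close> in \<open>S\<close> lie in
  \<open>K \<union> W\<close>, where \<open>K\<close> is a clique and \<open>W\<close> consists of
  promoted vertices. The arcs that promotion forces inside \<open>K \<union> W\<close> keep
  \<open>W\<close> small by sparsity.\<close>

lemma colour_step:
  assumes x: "x \<in> V - A" and v: "v \<in> component A x" and A: "A \<subseteq> V"
    and K: "complete_on (E `` component A x \<inter> A)"
    and full: "\<And>k. k \<in> E `` component A x \<inter> A \<Longrightarrow> (v, k) \<in> E"
    and S: "S \<in> grow (insert v A)" and w: "w \<in> S \<inter> component A x"
  shows "card (E `` {w} \<inter> S) < \<omega> + promoted_bound"
proof -
  let ?X = "component A x"
  define K where "K = insert v (E `` ?X \<inter> A)"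
  define W where "W = S \<inter> ?X - {v}"
  have XV: "?X \<subseteq> V - A" using component_subset x by blast
  have KV: "K \<subseteq> V" using A XV v by (auto simp: K_def)
  have "complete_on K"
    using K full sym_E unfolding K_def complete_on_def sym_def by blast
  with KV have cK: "card K \<le> \<omega>" by (rule clique_le)
  have WV: "W \<subseteq> V" using XV by (auto simp: W_def)
  have fin: "finite K" "finite W" using KV WV finite_V finite_subset by blast+
  \<comment> \<open>A vertex adjacent to the component is either in \<open>A\<close>, hence an
    attachment, or in the component itself.\<close>
  have nb: "y \<in> K \<union> W" if "y \<in> S" "z \<in> ?X" "(z, y) \<in> E" for y z
  proof (cases "y \<in> A")
    case True
    then show ?thesis using that by (auto simp: K_def)
  next
    case False
    then have "y \<in> ?X" using component_step that x by blast
    then show ?thesis using that by (auto simp: K_def W_def)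
  qed
  have "W \<inter> insert v A = {}" using XV by (auto simp: W_def)
  then have "2 * t * card (W \<inter> S) \<le> card {(x, y) \<in> F. x \<in> S \<and> y \<in> S \<and> (x \<in> W \<or> y \<in> W)}"
    by (rule grow_arcs[OF S])
  also have "\<dots> \<le> card (F \<inter> (K \<union> W) \<times> (K \<union> W))"
  proof (rule card_mono)
    show "finite (F \<inter> (K \<union> W) \<times> (K \<union> W))" using finite_F by auto
    have "p \<in> K \<union> W \<and> q \<in> K \<union> W" if "(p, q) \<in> F" "p \<in> S" "q \<in> S" "p \<in> W \<or> q \<in> W" for p q
    proof -
      have "(p, q) \<in> E" "(q, p) \<in> E" using that F_subset sym_E by (auto simp: sym_def)
      then show ?thesis using that nb[of q p] nb[of p q] by (auto simp: W_def)
    qed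
    then show "{(x, y) \<in> F. x \<in> S \<and> y \<in> S \<and> (x \<in> W \<or> y \<in> W)} \<subseteq> F \<inter> (K \<union> W) \<times> (K \<union> W)"
      by blast
  qed
  finally have "real (2 * t * card (W \<inter> S)) \<le> real (card (F \<inter> (K \<union> W) \<times> (K \<union> W)))"
    by (rule of_nat_mono)
  also have "\<dots> \<le> d * real (card (K \<union> W))" using KV WV by (intro sparse) auto
  finally have "real (2 * t * card (W \<inter> S)) \<le> d * real (card (K \<union> W))" .
  moreover have "W \<inter> S = W" by (auto simp: W_def)
  moreover have "d * real (card (K \<union> W)) \<le> d * (real \<omega> + real (card W))"
    using card_Un_le[of K W] cK d_pos by (intro mult_left_mono) linarith+
  \<comment> \<open>Rearranged from
    \<open>2 * t * card W \<le> d * (\<omega> + card W)\<close>.\<close>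
  ultimately have "real (card W) * (2 * real t - d) \<le> d * real \<omega>"
    by (simp add: algebra_simps)
  then have "real (card W) \<le> d * real \<omega> / (2 * real t - d)"
    using t_large by (simp add: pos_le_divide_eq)
  then have cW: "card W \<le> promoted_bound"
    unfolding promoted_bound_def by (simp add: le_floor_iff le_nat_iff)
  have "(w, w) \<notin> E" using irrefl_E by (auto simp: irrefl_def)
  moreover have wKW: "w \<in> K \<union> W" using w by (auto simp: K_def W_def)
  \<comment> \<open>The inclusion is strict because \<open>w\<close> belongs to
    \<open>K \<union> W\<close> without being its own neighbour.\<close>
  ultimately have "E `` {w} \<inter> S \<subset> K \<union> W" using nb w by auto
  then have "card (E `` {w} \<inter> S) < card (K \<union> W)" using fin by (intro psubset_card_mono) auto
  then show ?thesis using card_Un_le[of K W] cK cW by linarith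
qed

text \<open>Each round moves one vertex \<open>v\<close> into \<open>A\<close>, resaturates
  \<open>S\<close> to \<open>S'\<close>, and colours \<open>S' - S\<close>. Vertices of
  \<open>S' - S\<close> were outside the old saturated \<open>S\<close>, so each has fewer than
  \<open>t\<close> neighbours of \<open>F\<close> there.\<close>

lemma colouring_from:
  assumes "A \<subseteq> S" "clique_separated A" "S \<in> grow A" "proper_on S c"
    and "\<And>w. w \<in> V - S \<Longrightarrow> card (F `` {w} \<inter> S) < t"
  shows "\<exists>c. proper_on V c"
  using assms
proof (induction "card (V - A)" arbitrary: A S c)
  case 0
  then have "V \<subseteq> A" using finite_V by auto
  then have "S = V" using 0 grow_subset by blast
  then show ?case using 0 by auto
next
  case (Suc n)
  have SV: "S \<subseteq> V" using Suc.prems grow_subset by blast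
  have "V - A \<noteq> {}" using Suc.hyps(2) by (metis card.empty nat.distinct(1))
  then obtain x where x: "x \<in> V - A" by blast
  let ?K = "E `` component A x \<inter> A"
  have K: "complete_on ?K" using Suc.prems(2) x by (auto simp: clique_separated_def)
  obtain v where v: "v \<in> component A x" "\<And>k. k \<in> ?K \<Longrightarrow> (v, k) \<in> E"
    using common_neighbour_of_clique[OF x K] by blast
  have vA: "v \<in> V - A" using component_subset x v by blast
  obtain S' where S': "S \<subseteq> S'" "S' \<in> grow (insert v A)" "v \<in> S'" "S' - S \<subseteq> component A x"
    "\<And>w. w \<in> V - S' \<Longrightarrow> card (F `` {w} \<inter> S') < t"
    using saturate[OF Suc.prems(1) x v(1) Suc.prems(3) Suc.prems(5)] by blast
  have S'V: "S' \<subseteq> V" using S' grow_subset by blast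
  have un: "S \<union> (S' - S) = S'" using S' by auto
  have "\<exists>c'. proper_on (S \<union> (S' - S)) c'"
  proof (rule extend_colouring[OF Suc.prems(4)])
    show "card (E `` {w} \<inter> (S \<union> (S' - S))) < \<omega> + promoted_bound" if "w \<in> S' - S" for w
      unfolding un using colour_step[OF x v(1) _ K v(2) S'(2)] that S' Suc.prems(1) SV by blast
    show "card (F `` {w} \<inter> S) < t" if "w \<in> S' - S" for w
      using Suc.prems(5)[of w] that S'V by auto
  qed (use S'V in auto)
  then obtain c' where c': "proper_on S' c'" unfolding un by blast
  have "n = card (V - insert v A)"
    using Suc.hyps(2) vA finite_V by (metis Diff_insert card_Diff_singleton diff_Suc_1)
  moreover have "insert v A \<subseteq> S'" using S' Suc.prems(1) by auto
  moreover have "clique_separated (insert v A)"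
    by (rule clique_separated_insert[OF Suc.prems(2) x v])
  ultimately show ?case using Suc.hyps(1) S'(2,5) c' by blast
qed

lemma exists_colouring: "\<exists>c. proper_on V c"
proof (rule colouring_from)
  show "clique_separated {}" by (simp add: clique_separated_def complete_on_def)
  show "{} \<in> grow {}" by (rule grow.empty)
  show "proper_on {} (\<lambda>_. 0)" by (simp add: proper_on_def)
  \<comment> \<open>Saturation of the empty set amounts to \<open>0 < t\<close>.\<close>
  show "card (F `` {w} \<inter> {}) < t" for w using t_large d_pos by simp
qed simp

end

subsection \<open>Chordal graphs and maximum average degree\<close>

lemma pcas_consecutive:
  "a \<le> b \<Longrightarrow> pcas (h a) (map (\<lambda>i. (h i, h (Suc i))) [a..<b]) (h b)"
  by (induction "b - a" arbitrary: a) (simp_all add: upt_conv_Cons)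

lemma pawalk_verts_consecutive:
  "a \<le> b \<Longrightarrow> pawalk_verts (h a) (map (\<lambda>i. (h i, h (Suc i))) [a..<b]) = map h [a..<Suc b]"
proof (induction "b - a" arbitrary: a)
  case (Suc m)
  then have "a < b" by simp
  then show ?case using Suc(1)[of "Suc a"] Suc(2) by (simp add: upt_conv_Cons)
qed simp

lemma pair_graph_arcs:
  assumes "pair_graph G"
  shows "finite (pverts G)" "parcs G \<subseteq> pverts G \<times> pverts G" "sym (parcs G)" "irrefl (parcs G)"
proof -
  interpret pair_graph G by fact
  show "finite (pverts G)" by (rule pair_finite_verts)
  show "parcs G \<subseteq> pverts G \<times> pverts G" using in_arcsD1 in_arcsD2 by auto
  show "sym (parcs G)" using pair_sym_arcs by (simp add: symmetric_def)
  show "irrefl (parcs G)" using pair_no_loops by (fastforce simp: irrefl_def)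
qed

lemma pair_graphI:
  assumes "finite (pverts G)" "parcs G \<subseteq> pverts G \<times> pverts G" "sym (parcs G)" "irrefl (parcs G)"
  shows "pair_graph G"
proof
  show "finite (parcs G)" using assms by (meson finite_SigmaI finite_subset)
  show "symmetric (with_proj G)" using assms by (simp add: symmetric_def)
qed (use assms in \<open>auto simp: irrefl_def\<close>)

definition induced :: "'a pair_pre_digraph \<Rightarrow> 'a set \<Rightarrow> 'a pair_pre_digraph" where
  "induced G S = \<lparr>pverts = pverts G \<inter> S, parcs = parcs G \<inter> S \<times> S\<rparr>"

lemma induced_simps [simp]:
  "pverts (induced G S) = pverts G \<inter> S" "parcs (induced G S) = parcs G \<inter> S \<times> S"
  by (simp_all add: induced_def)

lemma pair_graph_induced: "pair_graph G \<Longrightarrow> pair_graph (induced G S)"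
  using pair_graph_arcs[of G] by (intro pair_graphI) (auto simp: sym_def irrefl_def)

lemma subgraph_with_proj_iff:
  assumes "pair_graph G" "pair_graph H"
  shows "subgraph (with_proj H) (with_proj G) \<longleftrightarrow> pverts H \<subseteq> pverts G \<and> parcs H \<subseteq> parcs G"
  using assms by (auto simp: subgraph_def wf_digraph_wp_iff pair_graph_def pair_digraph_def
      pair_fin_digraph_def)

lemma induced_subgraph_induced:
  assumes "pair_graph G"
  shows "induced_subgraph (with_proj (induced G S)) (with_proj G)"
proof -
  have "subgraph (with_proj (induced G S)) (with_proj G)"
    using assms by (simp add: subgraph_with_proj_iff pair_graph_induced)
  then show ?thesis
    using pair_graph_arcs(2)[OF assms] by (auto simp: induced_subgraph_def)
qed

lemma chordal_no_hole:
  assumes G: "pair_graph G" and chordal: "chordal G"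
    and n: "4 \<le> n" and inj: "inj_on g {..<n}" and gV: "g ` {..<n} \<subseteq> pverts G"
  shows "\<not> (\<forall>i<n. \<forall>j<n. (g i, g j) \<in> parcs G \<longleftrightarrow> j = Suc i mod n \<or> i = Suc j mod n)"
proof
  assume adj: "\<forall>i<n. \<forall>j<n. (g i, g j) \<in> parcs G \<longleftrightarrow> j = Suc i mod n \<or> i = Suc j mod n"
  define C where "C = induced G (g ` {..<n})"
  \<comment> \<open>Periodic extension of \<open>g\<close>: the closing arc becomes an ordinary step
    from \<open>h (n - 1)\<close> to \<open>h n = h 0\<close>.\<close>
  define h where "h i = g (i mod n)" for i
  define p where "p = map (\<lambda>i. (h i, h (Suc i))) [0..<n]"
  have VC: "pverts C = g ` {..<n}" using gV by (auto simp: C_def)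
  have pC: "pair_graph C" unfolding C_def by (rule pair_graph_induced) (rule G)
  have set_p: "set p = (\<lambda>i. (g i, g (Suc i mod n))) ` {..<n}"
    by (auto simp: p_def h_def image_iff)
  have arcs: "parcs C = set p \<union> (set p)\<inverse>"
  proof (intro equalityI subrelI)
    fix x y assume "(x, y) \<in> parcs C"
    then obtain i j where ij: "i < n" "j < n" "x = g i" "y = g j" "(g i, g j) \<in> parcs G"
      by (auto simp: C_def)
    then have "j = Suc i mod n \<or> i = Suc j mod n" using adj by blast
    then show "(x, y) \<in> set p \<union> (set p)\<inverse>" using ij unfolding set_p by auto
  next
    fix x y assume "(x, y) \<in> set p \<union> (set p)\<inverse>"
    then obtain i where i: "i < n" "(x = g i \<and> y = g (Suc i mod n)) \<or> (y = g i \<and> x = g (Suc i mod n))"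
      unfolding set_p by auto
    moreover have "Suc i mod n < n" using n by simp
    ultimately show "(x, y) \<in> parcs C" using adj by (auto simp: C_def)
  qed
  \<comment> \<open>The vertices after the start are a rotation of the original list, so injectivity
    of \<open>g\<close> makes them distinct.\<close>
  have "map h [1..<Suc n] = rotate1 (map g [0..<n])"
    using n by (auto simp: h_def upt_conv_Cons[of 0 n])
  moreover have "distinct (map g [0..<n])"
    using inj by (simp add: distinct_map atLeast0LessThan)
  ultimately have dist: "distinct (map h [1..<Suc n])" by simp
  have h0: "h n = h 0" by (simp add: h_def)
  have "pre_digraph.cycle (with_proj C) p"
    unfolding pre_digraph.cycle_def pre_digraph.awalk_def cas_with_proj_eq awalk_verts_with_proj_eq
  proof (intro exI conjI)
    show "h 0 \<in> verts (with_proj C)" using n by (auto simp: VC h_def)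
    show "set p \<subseteq> arcs (with_proj C)" using arcs by auto
    show "pcas (h 0) p (h 0)" using pcas_consecutive[of 0 n h] by (simp add: p_def h0)
    have "pawalk_verts (h 0) p = map h [0..<Suc n]"
      unfolding p_def by (rule pawalk_verts_consecutive) simp
    then show "distinct (tl (pawalk_verts (h 0) p))"
      using dist by (simp add: upt_conv_Cons del: upt_Suc)
    show "p \<noteq> []" using n by (simp add: p_def)
  qed
  moreover have "length p = n" by (simp add: p_def)
  moreover have "pverts C = fst ` set p" by (simp add: VC set_p image_image)
  ultimately have "cycle_graph n C" using pC n arcs unfolding cycle_graph_def by auto
  moreover have "induced_subgraph (with_proj C) (with_proj G)"
    unfolding C_def by (rule induced_subgraph_induced) (rule G)
  ultimately show False using chordal n unfolding chordal_def by blast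
qed

text \<open>Each edge \<open>{u, v}\<close> comes from at most the two arcs \<open>(u, v)\<close>
  and \<open>(v, u)\<close>. This turns the edge count in \<open>Mad\<close> into the arc count in
  \<open>sparse\<close>.\<close>

lemma card_parcs_le:
  assumes "pair_graph H"
  shows "card (parcs H) \<le> 2 * card (edges H)"
proof -
  have fin: "finite (parcs H)"
    using pair_graph_arcs[OF assms] by (meson finite_SigmaI finite_subset)
  have edges: "edges H = (\<lambda>(u, v). {u, v}) ` parcs H" by (auto simp: edges_def)
  have "parcs H = (\<Union>e\<in>edges H. {p \<in> parcs H. {fst p, snd p} = e})"
    by (force simp: edges_def)
  also have "card \<dots> \<le> (\<Sum>e\<in>edges H. card {p \<in> parcs H. {fst p, snd p} = e})"
    using fin by (intro card_UN_le) (simp add: edges)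
  also have "\<dots> \<le> (\<Sum>e\<in>edges H. 2)"
  proof (rule sum_mono)
    fix e assume "e \<in> edges H"
    then obtain u v where e: "e = {u, v}" by (auto simp: edges_def)
    have "{p \<in> parcs H. {fst p, snd p} = e} \<subseteq> {(u, v), (v, u)}"
      by (auto simp: e doubleton_eq_iff)
    then have "card {p \<in> parcs H. {fst p, snd p} = e} \<le> card {(u, v), (v, u)}"
      by (intro card_mono) auto
    also have "\<dots> \<le> 2" by (cases "u = v") auto
    finally show "card {p \<in> parcs H. {fst p, snd p} = e} \<le> 2" .
  qed
  finally show ?thesis by simp
qed

text \<open>If \<open>S\<close> meets \<open>H\<close>, the subgraph of \<open>H\<close> induced on
  \<open>S\<close> is among those over which \<open>Mad\<close> maximises; otherwise there are no
  arcs to count.\<close>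

lemma Mad_sparse:
  assumes H: "pair_graph H" and d: "Mad H \<le> d" "0 \<le> d" and S: "finite S"
  shows "real (card (parcs H \<inter> S \<times> S)) \<le> d * real (card S)"
proof (cases "pverts H \<inter> S = {}")
  case True
  then have "parcs H \<inter> S \<times> S = {}" using pair_graph_arcs(2)[OF H] by auto
  then show ?thesis using d by simp
next
  case False
  let ?P = "\<lambda>H'. pair_graph H' \<and> subgraph (with_proj H') (with_proj H) \<and> pverts H' \<noteq> {}"
  let ?f = "\<lambda>H'. 2 * real (card (edges H')) / real (card (pverts H'))"
  let ?I = "induced H S"
  have finV: "finite (pverts H)" using pair_graph_arcs[OF H] by simp
  then have fin: "finite (parcs H)"
    using pair_graph_arcs(2)[OF H] by (meson finite_SigmaI finite_subset)
  \<comment> \<open>A subgraph is determined by its vertex and arc sets, so the maximum is over a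
    finite set.\<close>
  have "{H'. ?P H'} \<subseteq> (\<lambda>(a, b). \<lparr>pverts = a, parcs = b\<rparr>) ` (Pow (pverts H) \<times> Pow (parcs H))"
  proof
    fix H' :: "'a pair_pre_digraph" assume "H' \<in> {H'. ?P H'}"
    then have "pverts H' \<subseteq> pverts H" "parcs H' \<subseteq> parcs H" by (auto simp: subgraph_def)
    moreover have "H' = \<lparr>pverts = pverts H', parcs = parcs H'\<rparr>" by simp
    ultimately show "H' \<in> (\<lambda>(a, b). \<lparr>pverts = a, parcs = b\<rparr>) ` (Pow (pverts H) \<times> Pow (parcs H))"
      by (metis (mono_tags, lifting) PowI SigmaI case_prod_conv image_eqI)
  qed
  then have "finite {H'. ?P H'}" by (rule finite_subset) (use finV fin in simp)
  then have "finite {?f H' | H'. ?P H'}" by (rule finite_image_set)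
  moreover have "?P ?I"
    using H False pair_graph_induced[OF H, of S] by (simp add: subgraph_with_proj_iff)
  ultimately have "?f ?I \<le> Max {?f H' | H'. ?P H'}" by (intro Max_ge) blast+
  also have "\<dots> = Mad H" using False by (auto simp: Mad_def)
  finally have "?f ?I \<le> d" using d by simp
  moreover have "0 < card (pverts ?I)" using False S by (simp add: card_gt_0_iff)
  ultimately have "2 * real (card (edges ?I)) \<le> d * real (card (pverts ?I))"
    by (simp add: pos_divide_le_eq)
  moreover have "card (parcs ?I) \<le> 2 * card (edges ?I)"
    by (rule card_parcs_le) (rule pair_graph_induced[OF H])
  ultimately have "real (card (parcs ?I)) \<le> d * real (card (pverts ?I))" by linarith
  also have "\<dots> \<le> d * real (card S)"
    using S d by (intro mult_left_mono) (simp_all add: card_mono)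
  finally show ?thesis by simp
qed

lemma card_le_clique_number:
  assumes G: "pair_graph G" and K: "K \<subseteq> pverts G"
    "\<And>x y. x \<in> K \<Longrightarrow> y \<in> K \<Longrightarrow> x \<noteq> y \<Longrightarrow> (x, y) \<in> parcs G"
  shows "card K \<le> clique_number G"
  unfolding clique_number_def
proof (rule Max_ge)
  have "{card K | K. K \<subseteq> pverts G \<and> clique K (edges G)} \<subseteq> card ` Pow (pverts G)" by auto
  then show "finite {card K | K. K \<subseteq> pverts G \<and> clique K (edges G)}"
    using pair_graph_arcs(1)[OF G] by (meson finite_Pow_iff finite_imageI finite_subset)
  have "clique K (edges G)" using K(2) by (auto simp: clique_def edges_def)
  then show "card K \<in> {card K | K. K \<subseteq> pverts G \<and> clique K (edges G)}" using K(1) by blast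
qed

section \<open>Choice of the threshold and the final count\<close>

theorem theorem2:
  fixes d :: real and G H :: "'a pair_pre_digraph"
  assumes "d > 0"
    and "pair_graph G" and "chordal G"
    and "pair_graph H" and "subgraph (with_proj H) (with_proj G)"
    and "Mad H \<le> d"
  shows "real (BBC 2 G H)
           \<le> real (clique_number G) + 2 * sqrt (d * real (clique_number G)) + 3 * d"
proof (cases "pverts G = {}")
  case True
  then have "parcs G = {}" using pair_graph_arcs(2)[OF assms(2)] by auto
  moreover have "parcs H \<subseteq> parcs G" using assms(5) by (auto simp: subgraph_def)
  ultimately have "backbone_colouring 2 0 G H (\<lambda>_. 0)"
    using True by (simp add: backbone_colouring_def)
  then have "BBC 2 G H \<le> 0" unfolding BBC_def by (intro Least_le) blast
  then show ?thesis using \<open>d > 0\<close> by simp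
next
  case False
  let ?\<omega> = "clique_number G"
  define s where "s = sqrt (d * real ?\<omega>)"
  \<comment> \<open>\<open>promoted_bound\<close> is at most \<open>s * s / (2 * t - d)\<close>,
    which competes with the term \<open>2 * t\<close>. Taking \<open>2 * t - d\<close> just above
    \<open>s\<close> makes the quotient at most \<open>s\<close>; rounding up costs less than 2,
    which \<open>2 * (t - 1)\<close> absorbs.\<close>
  define t where "t = nat \<lceil>(s + d) / 2\<rceil>"
  note G = pair_graph_arcs[OF assms(2)]
  have HG: "parcs H \<subseteq> parcs G" using assms(5) by (auto simp: subgraph_def)
  obtain v where v: "v \<in> pverts G" using False by blast
  \<comment> \<open>A single vertex is a clique; hence \<open>s\<close> is positive and may be
    divided by.\<close>
  have "1 \<le> ?\<omega>" using card_le_clique_number[OF assms(2), of "{v}"] v by simp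
  then have s: "0 < s" "s * s = d * real ?\<omega>" using \<open>d > 0\<close> by (simp_all add: s_def)
  have t: "s + d \<le> 2 * real t" "2 * real t < s + d + 2" "1 \<le> t"
  proof -
    have "real t = of_int \<lceil>(s + d) / 2\<rceil>" using s \<open>d > 0\<close> by (simp add: t_def)
    then have "(s + d) / 2 \<le> real t" "real t < (s + d) / 2 + 1" by linarith+
    then show le: "s + d \<le> 2 * real t" and "2 * real t < s + d + 2"
      by (simp_all add: field_simps)
    have "0 < 2 * real t" using le s(1) \<open>d > 0\<close> by linarith
    then show "1 \<le> t" by simp
  qed
  interpret sparse_backbone "pverts G" "parcs G" "parcs H" d ?\<omega> t
  proof
    show "\<not> (\<forall>i<n. \<forall>j<n. (g i, g j) \<in> parcs G \<longleftrightarrow> j = Suc i mod n \<or> i = Suc j mod n)"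
      if "4 \<le> n" "inj_on g {..<n}" "g ` {..<n} \<subseteq> pverts G" for n and g :: "nat \<Rightarrow> 'a"
      using chordal_no_hole[OF assms(2,3) that] .
    show "card K \<le> ?\<omega>" if "K \<subseteq> pverts G" "symmetric_rel.complete_on (parcs G) K" for K
    proof (rule card_le_clique_number[OF assms(2) that(1)])
      interpret symmetric_rel "pverts G" "parcs G" by unfold_locales (fact G)+
      show "(x, y) \<in> parcs G" if "x \<in> K" "y \<in> K" "x \<noteq> y" for x y
        using that \<open>symmetric_rel.complete_on (parcs G) K\<close> by (simp add: complete_on_def)
    qed
    show "real (card (parcs H \<inter> S \<times> S)) \<le> d * real (card S)" if "S \<subseteq> pverts G" for S
      using Mad_sparse[OF assms(4,6)] \<open>d > 0\<close> finite_subset[OF that G(1)] by simp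
    show "sym (parcs H)" by (rule pair_graph_arcs[OF assms(4)])
    show "d < 2 * real t" using s t by linarith
  qed (use G HG \<open>d > 0\<close> in auto)
  obtain c where "proper_on (pverts G) c" using exists_colouring by blast
  then have "backbone_colouring 2 colours G H c"
    using G(2) HG unfolding backbone_colouring_def proper_on_def by fastforce
  then have "BBC 2 G H \<le> colours" unfolding BBC_def by (intro Least_le) blast
  then have "real (BBC 2 G H) \<le> real colours" by simp
  moreover have "real promoted_bound \<le> s"
  proof -
    have le: "s \<le> 2 * real t - d" using t(1) by simp
    then have pos: "0 < 2 * real t - d" using s(1) by simp
    have "real promoted_bound \<le> s * s / (2 * real t - d)"
      unfolding promoted_bound_def s(2)[symmetric] using s(1) pos by (intro of_nat_floor) simp
    also have "\<dots> \<le> s * s / s" using s(1) le by (intro divide_left_mono mult_pos_pos pos) simp_all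
    finally show ?thesis using s(1) by simp
  qed
  moreover have "real (nat \<lfloor>d\<rfloor>) \<le> d" using \<open>d > 0\<close> by (intro of_nat_floor) simp
  moreover have "real colours =
      real ?\<omega> + real promoted_bound + 2 * (real t - 1) + 2 * real (nat \<lfloor>d\<rfloor>)"
    using t(3) by (simp add: colours_def of_nat_diff)
  \<comment> \<open>The four terms of \<open>colours\<close> are at most \<open>\<omega>\<close>,
    \<open>s\<close>, \<open>s + d\<close> and \<open>2 * d\<close>.\<close>
  ultimately have "real (BBC 2 G H) \<le> real ?\<omega> + 2 * s + 3 * d"
    using t(2) by (simp add: algebra_simps)
  then show ?thesis by (simp add: s_def)
qed

end
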